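(* Every pure simplicial complex has a partition extender. That is, for every pure $d$-dimensional simplicial complex $\Delta$ there exists a pure $d$-dimensional simplicial complex $\Gamma$ such that $\Delta\subseteq\Gamma$, $\Gamma$ is partitionable, and the relative complex $(\Gamma,\Delta)$ is partitionable.
   Context: All simplicial complexes are finite: a simplicial complex is a collection $\Delta$ of finite subsets of a finite ground set, closed under taking subsets. Its elements are faces, maximal faces are facets, $\dim\sigma=|\sigma|-1$, $\dim\Delta$ is the maximal dimension of a face, and $\Delta$ is pure if all its facets have the same dimension. The complex $\Gamma$ may use more vertices than $\Delta$. For a subcomplex $\Delta$ of a simplicial complex $\Gamma$, the relative complex $(\Gamma,\Delta)$ is the set of faces of $\Gamma$ not in $\Delta$. The face poset of a (relative) complex is its set of faces ordered by inclusion. An interval $[\sigma,\tau]=\{e : \sigma\le e\le\tau\}$ in a poset $P$ is Boolean if it is isomorphic to the poset of all subsets of a $k$-element set for some $k\ge 0$. A poset $P$ is partitionable if it is a disjoint union of Boolean intervals $I_1\sqcup\cdots\sqcup I_m$ such that the maximum element of each $I_j$ is a maximal element of $P$. A (relative) complex is partitionable if its face poset is partitionable. A partition extender for a pure $d$-dimensional complex $\Delta$ is a pure $d$-dimensional complex $\Gamma\supseteq\Delta$ such that both $\Gamma$ and $(\Gamma,\Delta)$ are partitionable. *)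

theory Defs
  imports Main "HOL-Library.Disjoint_Sets"
begin

section \<open>Partitionable posets\<close>

text \<open>A finite poset is given by its carrier \<open>P\<close>, with the order inherited from the type.  Face
  posets are the instance where the type is \<open>'a set\<close>, ordered by inclusion.\<close>

definition maximal_in :: "'p::order set \<Rightarrow> 'p \<Rightarrow> bool" where
  "maximal_in P x \<longleftrightarrow> x \<in> P \<and> (\<forall>y\<in>P. x \<le> y \<longrightarrow> y = x)"

definition interval_in :: "'p::order set \<Rightarrow> 'p \<Rightarrow> 'p \<Rightarrow> 'p set" where
  "interval_in P \<sigma> \<tau> = {e \<in> P. \<sigma> \<le> e \<and> e \<le> \<tau>}"

definition boolean_poset :: "'p::order set \<Rightarrow> bool" where
  "boolean_poset I \<longleftrightarrow> (\<exists>(k::nat) f. bij_betw f I (Pow {..<k}) \<and>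
     (\<forall>x\<in>I. \<forall>y\<in>I. x \<le> y \<longleftrightarrow> f x \<subseteq> f y))"

text \<open>A Boolean interval is nonempty, so \<open>\<sigma> \<le> \<tau>\<close> holds below and \<open>\<tau>\<close> is the maximum element
  of the block.  The empty poset is partitionable, by the partition with no blocks.\<close>

definition partitionable :: "'p::order set \<Rightarrow> bool" where
  "partitionable P \<longleftrightarrow> (\<exists>\<I>. finite \<I> \<and> partition_on P \<I> \<and>
     (\<forall>I\<in>\<I>. \<exists>\<sigma>\<in>P. \<exists>\<tau>\<in>P. I = interval_in P \<sigma> \<tau> \<and> boolean_poset I \<and> maximal_in P \<tau>))"

section \<open>Simplicial complexes\<close>

definition simplicial_complex :: "'a set set \<Rightarrow> bool" where
  "simplicial_complex \<Delta> \<longleftrightarrow> (\<exists>V. finite V \<and> \<Delta> \<subseteq> Pow V) \<and> (\<forall>\<sigma>\<in>\<Delta>. \<forall>\<tau>. \<tau> \<subseteq> \<sigma> \<longrightarrow> \<tau> \<in> \<Delta>)"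

abbreviation facet :: "'a set set \<Rightarrow> 'a set \<Rightarrow> bool" where
  "facet \<Delta> \<sigma> \<equiv> maximal_in \<Delta> \<sigma>"

definition face_dim :: "'a set \<Rightarrow> int" where
  "face_dim \<sigma> = int (card \<sigma>) - 1"

text \<open>The complex \<open>{{}}\<close> has dimension \<open>-1\<close>.  The void complex \<open>{}\<close> has no face and hence no
  meaningful dimension; its value here is the unspecified integer \<open>Max {}\<close>.\<close>

definition complex_dim :: "'a set set \<Rightarrow> int" where
  "complex_dim \<Delta> = Max (face_dim ` \<Delta>)"

definition pure :: "'a set set \<Rightarrow> bool" where
  "pure \<Delta> \<longleftrightarrow> (\<forall>\<sigma> \<tau>. facet \<Delta> \<sigma> \<longrightarrow> facet \<Delta> \<tau> \<longrightarrow> face_dim \<sigma> = face_dim \<tau>)"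

definition pure_complex :: "int \<Rightarrow> 'a set set \<Rightarrow> bool" where
  "pure_complex d \<Delta> \<longleftrightarrow> simplicial_complex \<Delta> \<and> pure \<Delta> \<and> complex_dim \<Delta> = d"

abbreviation relative_complex :: "'a set set \<Rightarrow> 'a set set \<Rightarrow> 'a set set" where
  "relative_complex \<Gamma> \<Delta> \<equiv> \<Gamma> - \<Delta>"

definition partition_extender :: "int \<Rightarrow> 'a set set \<Rightarrow> 'a set set \<Rightarrow> bool" where
  "partition_extender d \<Delta> \<Gamma> \<longleftrightarrow> pure_complex d \<Gamma> \<and> \<Delta> \<subseteq> \<Gamma> \<and>
     partitionable \<Gamma> \<and> partitionable (relative_complex \<Gamma> \<Delta>)"

end

theory Submission
  imports Defs
begin

text \<open>Let \<open>n = d + 1\<close> and let \<open>W\<close> be a large set of new vertices.  The extender is the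
  \<open>d\<close>-skeleton \<open>\<Gamma>\<close> of the join of \<open>\<Delta>\<close> with the full simplex on \<open>W\<close>, that is, all sets \<open>A\<close> with
  \<open>A - W \<in> \<Delta>\<close> and at most \<open>n\<close> elements.

  Before truncation to at most \<open>n\<close> elements, both posets split into intervals of sets.  The join
  itself is the disjoint union of the intervals \<open>[\<rho>, \<rho> \<union> W]\<close> over the faces \<open>\<rho>\<close> of \<open>\<Delta>\<close>.  The
  faces outside \<open>\<Delta>\<close> are the unions of a face \<open>\<rho>\<close> with a nonempty subset of \<open>W\<close>, so
  an interval decomposition of \<open>Pow W - {{}}\<close>, shifted by each \<open>\<rho>\<close>, decomposes them.  If all
  interval tops have at least \<open>n\<close> elements, truncation does no harm: an interval cut off at level
  \<open>n\<close> splits into intervals whose tops have exactly \<open>n\<close> elements (\<open>tiling_truncate\<close>), and these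
  are facets of \<open>\<Gamma>\<close>.

  It remains to decompose \<open>Pow W - {{}}\<close> into intervals with large tops
  (\<open>tiling_nonempty_subsets\<close>).  For three points this is
  \<open>[a, ab], [b, bc], [c, ca], [abc, abc]\<close>, and replacing the points by blocks gives an induction
  in which \<open>W\<close> triples whenever the bound on the tops grows by one.\<close>

section \<open>Decompositions into intervals of sets\<close>

text \<open>Building the disjoint union one interval at a time makes its closure properties plain
  inductions.  The set \<open>T\<close> of admissible tops carries the size bounds.  The intervals are those of
  the lattice of all sets, so that they can be handled before the complex is fixed.\<close>

inductive tiling :: "'a set set \<Rightarrow> 'a set set \<Rightarrow> bool" for T where
  empty: "tiling T {}"
| add: "tiling T Q \<Longrightarrow> \<sigma> \<subseteq> \<tau> \<Longrightarrow> \<tau> \<in> T \<Longrightarrow> {\<sigma>..\<tau>} \<inter> Q = {} \<Longrightarrow> tiling T ({\<sigma>..\<tau>} \<union> Q)"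

lemma tiling_interval: "\<sigma> \<subseteq> \<tau> \<Longrightarrow> \<tau> \<in> T \<Longrightarrow> tiling T {\<sigma>..\<tau>}"
  using tiling.add[OF tiling.empty] by force

lemma tiling_Un:
  assumes "tiling T P" "tiling T Q" "P \<inter> Q = {}"
  shows "tiling T (P \<union> Q)"
  using assms
proof (induction rule: tiling.induct)
  case empty
  then show ?case by simp
next
  case (add P \<sigma> \<tau>)
  then have "tiling T ({\<sigma>..\<tau>} \<union> (P \<union> Q))"
    by (intro tiling.add) blast+
  then show ?case by (simp add: Un_assoc)
qed

lemma tiling_UN:
  assumes "finite I" "\<And>i. i \<in> I \<Longrightarrow> tiling T (f i)" "disjoint_family_on f I"
  shows "tiling T (\<Union>i\<in>I. f i)"
  using assms
proof (induction rule: finite_induct)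
  case empty
  then show ?case by (simp add: tiling.empty)
next
  case (insert i I)
  then have "disjoint_family_on f I" "f i \<inter> (\<Union>j\<in>I. f j) = {}"
    by (auto simp: disjoint_family_on_insert)
  then have "tiling T (f i \<union> (\<Union>j\<in>I. f j))"
    using insert by (intro tiling_Un) auto
  then show ?case by simp
qed

text \<open>The product of a tiling on the vertex set \<open>V\<close> with one interval that lives off \<open>V\<close>: the
  product of two intervals on disjoint vertex sets is again an interval.\<close>

lemma tiling_join_interval:
  assumes "tiling T Q" "Q \<subseteq> Pow V" "\<sigma> \<subseteq> \<tau>" "\<tau> \<inter> V = {}"
    and top: "\<And>\<beta>. \<beta> \<in> T \<Longrightarrow> \<beta> \<subseteq> V \<Longrightarrow> \<beta> \<union> \<tau> \<in> T'"
  shows "tiling T' {A. A \<inter> V \<in> Q \<and> A - V \<in> {\<sigma>..\<tau>}}"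
  using assms(1,2)
proof (induction rule: tiling.induct)
  case empty
  then show ?case by (simp add: tiling.empty)
next
  case (add Q \<alpha> \<beta>)
  have "\<beta> \<in> {\<alpha>..\<beta>}" using add.hyps by simp
  then have \<beta>: "\<beta> \<subseteq> V" using add.prems by blast
  have box: "{A. A \<inter> V \<in> {\<alpha>..\<beta>} \<and> A - V \<in> {\<sigma>..\<tau>}} = {\<alpha> \<union> \<sigma>..\<beta> \<union> \<tau>}"
  proof (intro set_eqI iffI)
    fix A assume "A \<in> {A. A \<inter> V \<in> {\<alpha>..\<beta>} \<and> A - V \<in> {\<sigma>..\<tau>}}"
    then show "A \<in> {\<alpha> \<union> \<sigma>..\<beta> \<union> \<tau>}" by auto
  next
    fix A assume "A \<in> {\<alpha> \<union> \<sigma>..\<beta> \<union> \<tau>}"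
    then have "\<alpha> \<subseteq> A" "\<sigma> \<subseteq> A" "A \<subseteq> \<beta> \<union> \<tau>" by auto
    moreover have "\<alpha> \<subseteq> V" "\<sigma> \<inter> V = {}" using \<beta> add.hyps(2) assms(3,4) by blast+
    ultimately have "\<alpha> \<subseteq> A \<inter> V" "A \<inter> V \<subseteq> \<beta>" "\<sigma> \<subseteq> A - V" "A - V \<subseteq> \<tau>"
      using \<beta> assms(4) by blast+
    then show "A \<in> {A. A \<inter> V \<in> {\<alpha>..\<beta>} \<and> A - V \<in> {\<sigma>..\<tau>}}" by simp
  qed
  have "tiling T' {\<alpha> \<union> \<sigma>..\<beta> \<union> \<tau>}"
    using add.hyps \<beta> assms(3) by (intro tiling_interval top) auto
  moreover have "tiling T' {A. A \<inter> V \<in> Q \<and> A - V \<in> {\<sigma>..\<tau>}}"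
    using add.IH add.prems by blast
  moreover have "{A. A \<inter> V \<in> {\<alpha>..\<beta>} \<and> A - V \<in> {\<sigma>..\<tau>}}
      \<inter> {A. A \<inter> V \<in> Q \<and> A - V \<in> {\<sigma>..\<tau>}} = {}"
    using add.hyps(4) by blast
  ultimately have "tiling T' ({A. A \<inter> V \<in> {\<alpha>..\<beta>} \<and> A - V \<in> {\<sigma>..\<tau>}}
      \<union> {A. A \<inter> V \<in> Q \<and> A - V \<in> {\<sigma>..\<tau>}})"
    unfolding box by (intro tiling_Un)
  moreover have "{A. A \<inter> V \<in> {\<alpha>..\<beta>} \<union> Q \<and> A - V \<in> {\<sigma>..\<tau>}} =
      {A. A \<inter> V \<in> {\<alpha>..\<beta>} \<and> A - V \<in> {\<sigma>..\<tau>}} \<union> {A. A \<inter> V \<in> Q \<and> A - V \<in> {\<sigma>..\<tau>}}"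
    by blast
  ultimately show ?case by metis
qed

section \<open>Truncation\<close>

text \<open>If \<open>\<sigma>\<close> is below level \<open>n\<close> and \<open>\<tau>\<close> above it, splitting on a vertex \<open>x\<close> of \<open>\<tau> - \<sigma>\<close> gives
  the two smaller intervals \<open>[\<sigma>, \<tau> - x]\<close> and \<open>[\<sigma> + x, \<tau>]\<close>, both of which still contain sets of
  size \<open>n\<close>.  The splitting stops at intervals that start or end exactly at level \<open>n\<close>.\<close>

lemma tiling_truncated_interval:
  assumes "finite \<tau>" "\<sigma> \<subseteq> \<tau>" "n \<le> card \<tau>"
  shows "tiling {A. finite A \<and> card A = n} {A \<in> {\<sigma>..\<tau>}. card A \<le> n}"
  using assms
proof (induction "card (\<tau> - \<sigma>)" arbitrary: \<sigma> \<tau> rule: less_induct)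
  case less
  let ?T = "{A. finite A \<and> card A = n}"
  have fin: "finite A" if "A \<subseteq> \<tau>" for A
    using that less.prems finite_subset by blast
  consider "n < card \<sigma>" | "card \<tau> = n" | "card \<sigma> = n" | "card \<sigma> < n" "n < card \<tau>"
    using less.prems by linarith
  then show ?case
  proof cases
    case 1
    then have "\<not> card A \<le> n" if "\<sigma> \<subseteq> A" "A \<subseteq> \<tau>" for A
      using card_mono[OF fin[OF that(2)] that(1)] by linarith
    then have "{A \<in> {\<sigma>..\<tau>}. card A \<le> n} = {}" by auto
    then show ?thesis by (simp only: tiling.empty)
  next
    case 2
    then have "card A \<le> n" if "A \<subseteq> \<tau>" for A
      using card_mono[OF less.prems(1) that] by simp
    then have "{A \<in> {\<sigma>..\<tau>}. card A \<le> n} = {\<sigma>..\<tau>}" by auto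
    then show ?thesis using less.prems 2 by (simp only: tiling_interval mem_Collect_eq)
  next
    case 3
    have "A = \<sigma>" if "\<sigma> \<subseteq> A" "A \<subseteq> \<tau>" "card A \<le> n" for A
      using card_seteq[OF fin[OF that(2)] that(1)] that(3) 3 by simp
    then have "{A \<in> {\<sigma>..\<tau>}. card A \<le> n} = {\<sigma>..\<sigma>}"
      using 3 less.prems by auto
    then show ?thesis using fin[OF less.prems(2)] 3
      by (simp only: tiling_interval mem_Collect_eq subset_refl)
  next
    case 4
    then have "\<sigma> \<noteq> \<tau>" by auto
    then obtain x where x: "x \<in> \<tau>" "x \<notin> \<sigma>"
      using less.prems(2) by blast
    have smaller: "card (\<tau> - {x} - \<sigma>) < card (\<tau> - \<sigma>)" "card (\<tau> - insert x \<sigma>) < card (\<tau> - \<sigma>)"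
      by (intro psubset_card_mono; use x less.prems(1) in blast)+
    have "tiling ?T {A \<in> {\<sigma>..\<tau> - {x}}. card A \<le> n}"
      by (rule less.hyps[OF smaller(1)]) (use less.prems x 4 in auto)
    moreover have "tiling ?T {A \<in> {insert x \<sigma>..\<tau>}. card A \<le> n}"
      by (rule less.hyps[OF smaller(2)]) (use less.prems x in auto)
    ultimately have "tiling ?T
        ({A \<in> {\<sigma>..\<tau> - {x}}. card A \<le> n} \<union> {A \<in> {insert x \<sigma>..\<tau>}. card A \<le> n})"
      by (rule tiling_Un) auto
    also have "{A \<in> {\<sigma>..\<tau> - {x}}. card A \<le> n} \<union> {A \<in> {insert x \<sigma>..\<tau>}. card A \<le> n}
        = {A \<in> {\<sigma>..\<tau>}. card A \<le> n}"
      using x by auto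
    finally show ?thesis .
  qed
qed

lemma tiling_truncate:
  assumes "tiling {A. finite A \<and> n \<le> card A} Q"
  shows "tiling {A. finite A \<and> card A = n} {A \<in> Q. card A \<le> n}"
  using assms
proof (induction rule: tiling.induct)
  case empty
  then show ?case by (simp add: tiling.empty)
next
  case (add Q \<sigma> \<tau>)
  have "tiling {A. finite A \<and> card A = n} {A \<in> {\<sigma>..\<tau>}. card A \<le> n}"
    using add.hyps by (intro tiling_truncated_interval) auto
  then have "tiling {A. finite A \<and> card A = n}
      ({A \<in> {\<sigma>..\<tau>}. card A \<le> n} \<union> {A \<in> Q. card A \<le> n})"
    using add.IH add.hyps(4) by (intro tiling_Un) auto
  moreover have "{A \<in> {\<sigma>..\<tau>} \<union> Q. card A \<le> n} = {A \<in> {\<sigma>..\<tau>}. card A \<le> n} \<union> {A \<in> Q. card A \<le> n}"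
    by blast
  ultimately show ?case by metis
qed

section \<open>The nonempty subsets of a large set\<close>

text \<open>Split \<open>W\<close> into three blocks \<open>X\<close>, \<open>Y\<close>, \<open>Z\<close> and sort the nonempty subsets by the blocks they
  meet: \<open>X\<close> and possibly \<open>Y\<close> only, \<open>Y\<close> and possibly \<open>Z\<close> only, \<open>Z\<close> and possibly \<open>X\<close> only, or all
  three.  Each class is tiled by the product of the tiling of one block with intervals
  having a nonempty top on the other blocks, so every top gains at least one element.\<close>

lemma tiling_nonempty_subsets:
  assumes "card W = 3 ^ n"
  shows "tiling {A. finite A \<and> n \<le> card A} (Pow W - {{}})"
  using assms
proof (induction n arbitrary: W)
  case 0
  then obtain w where "W = {w}" by (auto simp: card_1_singleton_iff)
  then have "Pow W - {{}} = {W..W}" by auto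
  moreover have "finite W" using \<open>W = {w}\<close> by simp
  ultimately show ?case by (simp only: tiling_interval mem_Collect_eq subset_refl le0)
next
  case (Suc n)
  let ?T = "\<lambda>n. {A :: 'a set. finite A \<and> n \<le> card A}"
  have cW: "card W = 3 ^ n + (3 ^ n + 3 ^ n)" using Suc.prems by simp
  have finW: "finite W" using cW card.infinite[of W] by fastforce
  obtain X where X: "X \<subseteq> W" "card X = 3 ^ n"
    using obtain_subset_with_card_n[of "3 ^ n" W] cW by auto
  have cWX: "card (W - X) = 3 ^ n + 3 ^ n"
    using X cW finW by (simp add: card_Diff_subset finite_subset)
  obtain Y where Y: "Y \<subseteq> W - X" "card Y = 3 ^ n"
    using obtain_subset_with_card_n[of "3 ^ n" "W - X"] cWX by auto
  define Z where "Z = W - X - Y"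
  have Z: "card Z = 3 ^ n"
    using Y cWX finW unfolding Z_def by (subst card_Diff_subset) (auto intro: finite_subset)
  have fin: "finite X" "finite Y" "finite Z"
    using X Y finW by (auto simp: Z_def intro: finite_subset)
  have ne: "X \<noteq> {}" "Y \<noteq> {}" "Z \<noteq> {}"
    using X(2) Y(2) Z by (metis card.empty power_not_zero zero_neq_numeral)+
  have disj: "X \<inter> Y = {}" "X \<inter> Z = {}" "Y \<inter> Z = {}" and W: "W = X \<union> Y \<union> Z"
    using X Y by (auto simp: Z_def)
  have prod: "tiling (?T (Suc n)) {A. A \<inter> U \<in> Pow U - {{}} \<and> A - U \<in> {\<sigma>..\<tau>}}"
    if "card U = 3 ^ n" "\<sigma> \<subseteq> \<tau>" "\<tau> \<inter> U = {}" "finite \<tau>" "\<tau> \<noteq> {}" for U \<sigma> \<tau>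
  proof (rule tiling_join_interval[OF Suc.IH])
    fix \<beta> assume "\<beta> \<in> ?T n" "\<beta> \<subseteq> U"
    moreover from this have "card (\<beta> \<union> \<tau>) = card \<beta> + card \<tau>"
      using that by (intro card_Un_disjoint) auto
    moreover have "0 < card \<tau>" using that by (simp add: card_gt_0_iff)
    ultimately show "\<beta> \<union> \<tau> \<in> ?T (Suc n)" using that by simp
  qed (use that in auto)
  let ?P = "\<lambda>U \<sigma> \<tau>. {A. A \<inter> U \<in> Pow U - {{}} \<and> A - U \<in> {\<sigma>..\<tau>}}"
  have two: "tiling (?T (Suc n)) {A. A \<subseteq> U \<union> U' \<and> A \<inter> U \<noteq> {}}"
    if "card U = 3 ^ n" "U' \<inter> U = {}" "finite U'" "U' \<noteq> {}" for U U'
  proof -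
    have "{A. A \<subseteq> U \<union> U' \<and> A \<inter> U \<noteq> {}} = ?P U {} U'" by auto
    then show ?thesis using prod[of U "{}" U'] that by simp
  qed
  have three: "tiling (?T (Suc n)) {A. A \<subseteq> W \<and> A \<inter> X \<noteq> {} \<and> A \<inter> Y \<noteq> {} \<and> A \<inter> Z \<noteq> {}}"
  proof -
    let ?B = "{B. B \<subseteq> Y \<union> Z \<and> B \<inter> Y \<noteq> {} \<and> B \<inter> Z \<noteq> {}}"
    have "finite ?B" using fin by simp
    then have "tiling (?T (Suc n)) (\<Union>B\<in>?B. ?P X B B)"
    proof (rule tiling_UN)
      fix B assume "B \<in> ?B"
      then have "B \<inter> X = {}" "finite B" "B \<noteq> {}"
        using disj finite_subset[of B "Y \<union> Z"] fin by blast+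
      then show "tiling (?T (Suc n)) (?P X B B)"
        using X(2) by (intro prod) auto
    qed (auto simp: disjoint_family_on_def)
    also have "(\<Union>B\<in>?B. ?P X B B) = {A. A \<subseteq> W \<and> A \<inter> X \<noteq> {} \<and> A \<inter> Y \<noteq> {} \<and> A \<inter> Z \<noteq> {}}"
    proof (intro set_eqI iffI)
      fix A assume "A \<in> (\<Union>B\<in>?B. ?P X B B)"
      then have "A - X \<in> ?B" "A \<inter> X \<noteq> {}" by auto
      then show "A \<in> {A. A \<subseteq> W \<and> A \<inter> X \<noteq> {} \<and> A \<inter> Y \<noteq> {} \<and> A \<inter> Z \<noteq> {}}"
        unfolding W by blast
    next
      fix A assume "A \<in> {A. A \<subseteq> W \<and> A \<inter> X \<noteq> {} \<and> A \<inter> Y \<noteq> {} \<and> A \<inter> Z \<noteq> {}}"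
      then have "A - X \<in> ?B" "A \<inter> X \<noteq> {}" using disj W by blast+
      then show "A \<in> (\<Union>B\<in>?B. ?P X B B)" by (intro UN_I[of "A - X"]) auto
    qed
    finally show ?thesis .
  qed
  have "tiling (?T (Suc n)) ({A. A \<subseteq> X \<union> Y \<and> A \<inter> X \<noteq> {}} \<union> {A. A \<subseteq> Y \<union> Z \<and> A \<inter> Y \<noteq> {}}
      \<union> {A. A \<subseteq> Z \<union> X \<and> A \<inter> Z \<noteq> {}} \<union> {A. A \<subseteq> W \<and> A \<inter> X \<noteq> {} \<and> A \<inter> Y \<noteq> {} \<and> A \<inter> Z \<noteq> {}})"
    (is "tiling _ ?L")
  proof (intro tiling_Un three)
    show "tiling (?T (Suc n)) {A. A \<subseteq> X \<union> Y \<and> A \<inter> X \<noteq> {}}"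
      "tiling (?T (Suc n)) {A. A \<subseteq> Y \<union> Z \<and> A \<inter> Y \<noteq> {}}"
      "tiling (?T (Suc n)) {A. A \<subseteq> Z \<union> X \<and> A \<inter> Z \<noteq> {}}"
      using X(2) Y(2) Z disj fin ne by (intro two; blast)+
  qed (use disj in blast)+
  also have "?L = Pow W - {{}}"
  proof (intro set_eqI iffI)
    fix A assume "A \<in> ?L"
    then show "A \<in> Pow W - {{}}" unfolding W by blast
  next
    fix A assume A: "A \<in> Pow W - {{}}"
    consider "A \<inter> X \<noteq> {}" "A \<inter> Z = {}" | "A \<inter> Y \<noteq> {}" "A \<inter> X = {}"
      | "A \<inter> Z \<noteq> {}" "A \<inter> Y = {}" | "A \<inter> X \<noteq> {}" "A \<inter> Y \<noteq> {}" "A \<inter> Z \<noteq> {}"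
      using A W by blast
    then show "A \<in> ?L"
      using A W by cases blast+
  qed
  finally show ?case .
qed

section \<open>From interval decompositions to partitionability\<close>

lemma boolean_poset_interval:
  assumes "finite \<tau>" "\<sigma> \<subseteq> \<tau>"
  shows "boolean_poset {\<sigma>..\<tau>}"
proof -
  obtain h where h: "bij_betw h (\<tau> - \<sigma>) {..<card (\<tau> - \<sigma>)}"
    using ex_bij_betw_finite_nat[of "\<tau> - \<sigma>"] assms by (auto simp: atLeast0LessThan)
  have diff: "bij_betw (\<lambda>A. A - \<sigma>) {\<sigma>..\<tau>} (Pow (\<tau> - \<sigma>))"
    by (rule bij_betw_byWitness[where f' = "\<lambda>A. A \<union> \<sigma>"]) (use assms in auto)
  have "bij_betw ((`) h \<circ> (\<lambda>A. A - \<sigma>)) {\<sigma>..\<tau>} (Pow {..<card (\<tau> - \<sigma>)})"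
    by (rule bij_betw_trans[OF diff bij_betw_Pow[OF h]])
  moreover have "A \<subseteq> B \<longleftrightarrow> h ` (A - \<sigma>) \<subseteq> h ` (B - \<sigma>)" if "A \<in> {\<sigma>..\<tau>}" "B \<in> {\<sigma>..\<tau>}" for A B
  proof -
    have "inj_on h (\<tau> - \<sigma>)" "A - \<sigma> \<subseteq> \<tau> - \<sigma>" "B - \<sigma> \<subseteq> \<tau> - \<sigma>"
      using h that by (auto simp: bij_betw_def)
    then have "h ` (A - \<sigma>) \<subseteq> h ` (B - \<sigma>) \<longleftrightarrow> A - \<sigma> \<subseteq> B - \<sigma>"
      by (auto simp: inj_on_def) blast
    then show ?thesis using that by auto
  qed
  ultimately show ?thesis unfolding boolean_poset_def comp_def by blast
qed

lemma tiling_imp_partition_on: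
  assumes "tiling T Q"
  shows "\<exists>\<I>. finite \<I> \<and> partition_on Q \<I> \<and> (\<forall>I\<in>\<I>. \<exists>\<sigma> \<tau>. I = {\<sigma>..\<tau>} \<and> \<sigma> \<subseteq> \<tau> \<and> \<tau> \<in> T)"
  using assms
proof (induction rule: tiling.induct)
  case empty
  then show ?case by (auto simp: partition_on_empty)
next
  case (add Q \<sigma> \<tau>)
  then obtain \<I> where \<I>: "finite \<I>" "partition_on Q \<I>"
    "\<forall>I\<in>\<I>. \<exists>\<sigma> \<tau>. I = {\<sigma>..\<tau>} \<and> \<sigma> \<subseteq> \<tau> \<and> \<tau> \<in> T" by blast
  have "partition_on ({\<sigma>..\<tau>} \<union> Q) (insert {\<sigma>..\<tau>} \<I>)"
  proof (subst partition_on_insert)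
    have "\<Union>\<I> = Q" using \<I>(2) by (simp add: partition_on_def)
    then show "disjnt {\<sigma>..\<tau>} (\<Union>\<I>)" using add.hyps(4) by (simp add: disjnt_def)
    have "{\<sigma>..\<tau>} \<union> Q - {\<sigma>..\<tau>} = Q" using add.hyps(4) by blast
    then show "partition_on ({\<sigma>..\<tau>} \<union> Q - {\<sigma>..\<tau>}) \<I> \<and> {\<sigma>..\<tau>} \<subseteq> {\<sigma>..\<tau>} \<union> Q \<and> {\<sigma>..\<tau>} \<noteq> {}"
      using \<I>(2) add.hyps(2) by simp
  qed
  then show ?case using \<I> add.hyps by (intro exI[of _ "insert {\<sigma>..\<tau>} \<I>"]) blast
qed

text \<open>An interval of the lattice of all sets that lies inside \<open>P\<close> is an interval of the poset
  \<open>P\<close>, hence a legitimate block once its top is maximal in \<open>P\<close>.\<close>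

lemma tiling_imp_partitionable:
  assumes "tiling T P" and top: "\<And>\<tau>. \<tau> \<in> T \<Longrightarrow> \<tau> \<in> P \<Longrightarrow> finite \<tau> \<and> maximal_in P \<tau>"
  shows "partitionable P"
proof -
  obtain \<I> where \<I>: "finite \<I>" "partition_on P \<I>"
    "\<forall>I\<in>\<I>. \<exists>\<sigma> \<tau>. I = {\<sigma>..\<tau>} \<and> \<sigma> \<subseteq> \<tau> \<and> \<tau> \<in> T"
    using tiling_imp_partition_on[OF assms(1)] by blast
  have "\<exists>\<sigma>\<in>P. \<exists>\<tau>\<in>P. I = interval_in P \<sigma> \<tau> \<and> boolean_poset I \<and> maximal_in P \<tau>"
    if "I \<in> \<I>" for I
  proof -
    obtain \<sigma> \<tau> where I: "I = {\<sigma>..\<tau>}" "\<sigma> \<subseteq> \<tau>" "\<tau> \<in> T"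
      using bspec[OF \<I>(3) \<open>I \<in> \<I>\<close>] by metis
    have sub: "I \<subseteq> P" using \<I>(2) that by (auto simp: partition_on_def)
    then have "\<sigma> \<in> P" "\<tau> \<in> P" "I = interval_in P \<sigma> \<tau>"
      using I by (auto simp: interval_in_def)
    then show ?thesis using top[of \<tau>] I boolean_poset_interval by metis
  qed
  then show ?thesis unfolding partitionable_def using \<I>(1,2) by blast
qed

text \<open>After truncation every top has \<open>n\<close> elements, the largest size that is left, and is
  therefore maximal.\<close>

lemma partitionable_truncation:
  assumes "tiling {A. finite A \<and> n \<le> card A} Q" "\<And>A. A \<in> Q \<Longrightarrow> finite A"
  shows "partitionable {A \<in> Q. card A \<le> n}"
proof (rule tiling_imp_partitionable[OF tiling_truncate[OF assms(1)]])
  fix \<tau> assume "\<tau> \<in> {A. finite A \<and> card A = n}" "\<tau> \<in> {A \<in> Q. card A \<le> n}"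
  then have \<tau>: "finite \<tau>" "card \<tau> = n" "\<tau> \<in> Q" by auto
  have "B = \<tau>" if "B \<in> Q" "card B \<le> n" "\<tau> \<subseteq> B" for B
    using card_seteq[OF assms(2)[OF that(1)] that(3)] that(2) \<tau>(2) by simp
  then show "finite \<tau> \<and> maximal_in {A \<in> Q. card A \<le> n} \<tau>"
    using \<tau> by (auto simp: maximal_in_def)
qed

section \<open>The extender\<close>

theorem theorem1p2:
  fixes \<Delta> :: "'a set set" and d :: int
  assumes "infinite (UNIV :: 'a set)"
    and "pure_complex d \<Delta>"
  shows "\<exists>\<Gamma> :: 'a set set. partition_extender d \<Delta> \<Gamma>"
proof (cases "\<Delta> = {}")
  case True
  \<comment> \<open>Here \<open>d\<close> is the unspecified \<open>Max {}\<close>, which bounds nothing; the void complex extends itself.\<close>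
  have "partitionable ({} :: 'a set set)"
    by (rule tiling_imp_partitionable[OF tiling.empty[of "{}"]]) auto
  then show ?thesis using True assms(2) by (auto simp: partition_extender_def)
next
  case False
  obtain V where V: "finite V" "\<Delta> \<subseteq> Pow V"
    and down: "\<And>\<sigma> \<tau>. \<sigma> \<in> \<Delta> \<Longrightarrow> \<tau> \<subseteq> \<sigma> \<Longrightarrow> \<tau> \<in> \<Delta>"
    and dim: "Max (face_dim ` \<Delta>) = d"
    using assms(2) by (auto simp: pure_complex_def simplicial_complex_def complex_dim_def)
  have fin\<Delta>: "finite \<Delta>" using V finite_subset by blast
  have empty: "{} \<in> \<Delta>" using False down by blast
  define n where "n = nat (d + 1)"
  have le_d: "face_dim \<rho> \<le> d" if "\<rho> \<in> \<Delta>" for \<rho>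
    using that fin\<Delta> by (auto simp flip: dim)
  have n: "int n = d + 1"
    using le_d[OF empty] by (simp add: n_def face_dim_def)
  have card_\<Delta>: "card \<rho> \<le> n" if "\<rho> \<in> \<Delta>" for \<rho>
    using le_d[OF that] n by (simp add: face_dim_def)
  have "infinite (UNIV - V)" using assms(1) V(1) by simp
  then obtain W where W: "finite W" "W \<subseteq> UNIV - V" "card W = 3 ^ n"
    using infinite_arbitrarily_large by metis
  have nW: "n \<le> card W"
    using power_gt_expt[of 3 n] W(3) by simp
  have disj: "\<rho> \<inter> W = {}" if "\<rho> \<in> \<Delta>" for \<rho>
    using that V(2) W(2) by blast
  have fin_join: "finite A" if "A - W \<in> \<Delta>" for A
    using that V W(1) by (metis PowD finite_Diff2 finite_subset subsetD)
  define \<Gamma> where "\<Gamma> = {A \<in> {A. A - W \<in> \<Delta>}. card A \<le> n}"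

  have "\<Delta> \<subseteq> \<Gamma>"
    using card_\<Delta> disj by (auto simp: \<Gamma>_def Diff_triv)

  have part: "partitionable \<Gamma>"
  proof -
    have "tiling {A. finite A \<and> n \<le> card A} (\<Union>\<rho>\<in>\<Delta>. {\<rho>..\<rho> \<union> W})"
    proof (rule tiling_UN[OF fin\<Delta>])
      fix \<rho> assume \<rho>: "\<rho> \<in> \<Delta>"
      then have "finite (\<rho> \<union> W)" by (intro fin_join) (simp add: Un_Diff Diff_triv disj)
      then show "tiling {A. finite A \<and> n \<le> card A} {\<rho>..\<rho> \<union> W}"
        using nW card_mono[of "\<rho> \<union> W" W] by (intro tiling_interval) auto
    next
      have "A - W = \<rho>" if "\<rho> \<in> \<Delta>" "A \<in> {\<rho>..\<rho> \<union> W}" for \<rho> A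
        using that disj by auto
      then show "disjoint_family_on (\<lambda>\<rho>. {\<rho>..\<rho> \<union> W}) \<Delta>"
        unfolding disjoint_family_on_def by blast
    qed
    also have "(\<Union>\<rho>\<in>\<Delta>. {\<rho>..\<rho> \<union> W}) = {A. A - W \<in> \<Delta>}"
    proof (intro equalityI subsetI)
      fix A assume "A \<in> (\<Union>\<rho>\<in>\<Delta>. {\<rho>..\<rho> \<union> W})"
      then obtain \<rho> where "\<rho> \<in> \<Delta>" "\<rho> \<subseteq> A" "A \<subseteq> \<rho> \<union> W" by auto
      moreover from this have "A - W = \<rho>" using disj by blast
      ultimately show "A \<in> {A. A - W \<in> \<Delta>}" by simp
    next
      fix A assume "A \<in> {A. A - W \<in> \<Delta>}"
      then show "A \<in> (\<Union>\<rho>\<in>\<Delta>. {\<rho>..\<rho> \<union> W})" by (intro UN_I[of "A - W"]) auto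
    qed
    finally show ?thesis
      unfolding \<Gamma>_def by (rule partitionable_truncation) (auto intro: fin_join)
  qed

  have rel: "partitionable (\<Gamma> - \<Delta>)"
  proof -
    let ?N = "\<lambda>\<rho>. {A. A \<inter> W \<in> Pow W - {{}} \<and> A - W \<in> {\<rho>..\<rho>}}"
    have "tiling {A. finite A \<and> n \<le> card A} (\<Union>\<rho>\<in>\<Delta>. ?N \<rho>)"
    proof (rule tiling_UN[OF fin\<Delta>])
      fix \<rho> assume \<rho>: "\<rho> \<in> \<Delta>"
      then have "finite \<rho>" by (intro fin_join) (simp add: Diff_triv disj)
      then have "\<beta> \<union> \<rho> \<in> {A. finite A \<and> n \<le> card A}" if "\<beta> \<in> {A. finite A \<and> n \<le> card A}" for \<beta>
        using that card_mono[of "\<beta> \<union> \<rho>" \<beta>] by auto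
      then show "tiling {A. finite A \<and> n \<le> card A} (?N \<rho>)"
        using disj[OF \<rho>] by (intro tiling_join_interval[OF tiling_nonempty_subsets[OF W(3)]]) auto
    qed (auto simp: disjoint_family_on_def)
    then have "partitionable {A \<in> (\<Union>\<rho>\<in>\<Delta>. ?N \<rho>). card A \<le> n}"
      by (rule partitionable_truncation) (auto intro: fin_join)
    also have "{A \<in> (\<Union>\<rho>\<in>\<Delta>. ?N \<rho>). card A \<le> n} = \<Gamma> - \<Delta>"
      using disj by (auto simp: \<Gamma>_def Diff_triv)
    finally show ?thesis .
  qed

  \<comment> \<open>Every face can be filled up with vertices of \<open>W\<close> to exactly \<open>n\<close> vertices.\<close>
  have extend: "\<exists>B\<in>\<Gamma>. A \<subseteq> B \<and> card B = n" if "A \<in> \<Gamma>" for A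
  proof -
    have A: "A - W \<in> \<Delta>" "card A \<le> n" using that by (auto simp: \<Gamma>_def)
    have fin: "finite (A \<union> W)" using fin_join[OF A(1)] W(1) by simp
    have "n \<le> card (A \<union> W)" using nW card_mono[OF fin, of W] by simp
    then obtain B where B: "A \<subseteq> B" "B \<subseteq> A \<union> W" "card B = n"
      using exists_subset_between[of A n "A \<union> W"] A(2) fin by blast
    then have "B - W = A - W" by blast
    then have "B \<in> \<Gamma>" using A(1) B(3) by (simp add: \<Gamma>_def)
    then show ?thesis using B by blast
  qed
  have "pure \<Gamma>"
  proof -
    have "card \<sigma> = n" if "facet \<Gamma> \<sigma>" for \<sigma>
      using that extend[of \<sigma>] by (auto simp: maximal_in_def)
    then show ?thesis by (simp add: pure_def face_dim_def)
  qed
  moreover have "simplicial_complex \<Gamma>"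
  proof -
    have "\<Gamma> \<subseteq> Pow (V \<union> W)" using V(2) by (auto simp: \<Gamma>_def)
    moreover have "\<tau> \<in> \<Gamma>" if "\<sigma> \<in> \<Gamma>" "\<tau> \<subseteq> \<sigma>" for \<sigma> \<tau>
    proof -
      have \<sigma>: "\<sigma> - W \<in> \<Delta>" "card \<sigma> \<le> n" using that(1) by (auto simp: \<Gamma>_def)
      have "\<tau> - W \<in> \<Delta>" using down[OF \<sigma>(1)] that(2) by blast
      then show ?thesis
        using \<sigma> card_mono[OF fin_join[OF \<sigma>(1)] that(2)] by (simp add: \<Gamma>_def)
    qed
    ultimately show ?thesis
      unfolding simplicial_complex_def using V(1) W(1) by (meson finite_UnI)
  qed
  moreover have "complex_dim \<Gamma> = d"
    unfolding complex_dim_def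
  proof (rule Max_eqI)
    have "\<Gamma> \<subseteq> Pow (V \<union> W)" using V(2) by (auto simp: \<Gamma>_def)
    then show "finite (face_dim ` \<Gamma>)" using V(1) W(1) finite_subset by blast
    show "y \<le> d" if "y \<in> face_dim ` \<Gamma>" for y
      using that n by (auto simp: \<Gamma>_def face_dim_def)
    obtain B where "B \<in> \<Gamma>" "card B = n"
      using extend[of "{}"] empty \<open>\<Delta> \<subseteq> \<Gamma>\<close> by blast
    then show "d \<in> face_dim ` \<Gamma>"
      using n by (intro image_eqI[of _ _ B]) (auto simp: face_dim_def)
  qed
  ultimately have "partition_extender d \<Delta> \<Gamma>"
    using \<open>\<Delta> \<subseteq> \<Gamma>\<close> part rel by (simp add: partition_extender_def pure_complex_def)
  then show ?thesis by blast
qed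

end
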